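(* Let $(G,\mathrm{val})$ be a $\mathbb{Z}$-invariant pseudo-complete valued abelian group. Then, for every integer $m>0$, the induced valued group modulo $m$, $(G/mG,\mathrm{val}^m)$, is pseudo-complete.
   Context: A valued abelian group is an abelian group $G$ with a surjection $\mathrm{val}:G\to\Gamma$ onto a linearly ordered set with maximum $\infty$ such that $\mathrm{val}(g)=\infty$ iff $g=0$, and $\mathrm{val}(g-h)\ge\min\{\mathrm{val}(g),\mathrm{val}(h)\}$. It is $\mathbb{Z}$-invariant if $\mathrm{val}(ng)=\mathrm{val}(g)$ for all $g\in G$ and all integers $n>0$. For $m>0$ and $a\in G$ let $V^m_a=\{x\in G\mid \mathrm{val}(a+mg)<\mathrm{val}(x)\text{ for all }g\in G\}$ (so $V^m_a=\emptyset$ if $a\in mG$). Let $\Gamma^m$ be the quotient of $G$ by the equivalence relation $V^m_a=V^m_b$, and $\mathrm{val}^m:G\to\Gamma^m$ the projection; order $\Gamma^m$ by $\mathrm{val}^m(a)<\mathrm{val}^m(b)$ iff $V^m_b\subsetneq V^m_a$, with maximum $\infty$ the class of $0$ (namely $mG$). The map $\mathrm{val}^m$ factors through $G/mG$ and defines a valuation, still denoted $\mathrm{val}^m$, on $G/mG$; $(G/mG,\mathrm{val}^m)$ is the induced valued group modulo $m$. A sequence $(a_i)_{i\in I}$ in a valued abelian group, with $I$ well-ordered without maximum, is pseudo-Cauchy if there is $\alpha\in I$ such that $\mathrm{val}(a_i-a_j)<\mathrm{val}(a_j-a_k)$ for all $\alpha<i<j<k$. An element $a$ is a pseudo-limit of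 it if there is $\alpha\in I$ with $\mathrm{val}(a_i-a)=\mathrm{val}(a_i-a_j)$ for all $\alpha<i<j$. A valued abelian group is pseudo-complete if every pseudo-Cauchy sequence in it has a pseudo-limit in it. *)

theory Defs
  imports "HOL-Algebra.Algebra"
begin

text \<open>
  Abelian groups are commutative groups of HOL-Algebra, hence written multiplicatively:
  \<open>g - h\<close> is \<open>g \<otimes> inv h\<close> and \<open>m g\<close> is \<open>g [^] m\<close>.
\<close>

locale valued_abelian_group = comm_group G + value_order: total_order \<Gamma>
  for G :: "('a, 'b) monoid_scheme" (structure)
  and \<Gamma> :: "('v, 'c) gorder_scheme" +
  fixes infty :: 'v and val :: "'a \<Rightarrow> 'v"
  assumes val_surj: "val ` carrier G = carrier \<Gamma>"
    and infty_greatest: "greatest \<Gamma> infty (carrier \<Gamma>)"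
    and val_eq_infty_iff: "g \<in> carrier G \<Longrightarrow> val g = infty \<longleftrightarrow> g = \<one>"
    and val_diff: "\<lbrakk>g \<in> carrier G; h \<in> carrier G\<rbrakk> \<Longrightarrow>
      (if val g \<sqsubseteq>\<^bsub>\<Gamma>\<^esub> val h then val g else val h) \<sqsubseteq>\<^bsub>\<Gamma>\<^esub> val (g \<otimes> inv h)"

definition Z_invariant :: "('a, 'b) monoid_scheme \<Rightarrow> ('a \<Rightarrow> 'v) \<Rightarrow> bool" where
  "Z_invariant G val \<longleftrightarrow> (\<forall>g\<in>carrier G. \<forall>n::nat. n > 0 \<longrightarrow> val (g [^]\<^bsub>G\<^esub> n) = val g)"


section \<open>Pseudo-completeness\<close>

text \<open>
  The index set \<open>I\<close> of a sequence is the field of a (reflexive) well-order \<open>r\<close>, with strict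
  order \<open>r - Id\<close>; values of \<open>a\<close> outside \<open>Field r\<close> are irrelevant.
\<close>

definition index_order :: "'i rel \<Rightarrow> bool" where
  "index_order r \<longleftrightarrow> Well_order r \<and> (\<forall>i\<in>Field r. \<exists>j. (i, j) \<in> r - Id)"

definition pseudo_Cauchy ::
  "('a, 'b) monoid_scheme \<Rightarrow> ('v, 'c) gorder_scheme \<Rightarrow> ('a \<Rightarrow> 'v) \<Rightarrow> 'i rel \<Rightarrow> ('i \<Rightarrow> 'a) \<Rightarrow> bool" where
  "pseudo_Cauchy G \<Gamma> val r a \<longleftrightarrow>
     (\<exists>\<alpha>\<in>Field r. \<forall>i j k.
        (\<alpha>, i) \<in> r - Id \<and> (i, j) \<in> r - Id \<and> (j, k) \<in> r - Id \<longrightarrow>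
        val (a i \<otimes>\<^bsub>G\<^esub> inv\<^bsub>G\<^esub> a j) \<sqsubset>\<^bsub>\<Gamma>\<^esub> val (a j \<otimes>\<^bsub>G\<^esub> inv\<^bsub>G\<^esub> a k))"

definition pseudo_limit ::
  "('a, 'b) monoid_scheme \<Rightarrow> ('a \<Rightarrow> 'v) \<Rightarrow> 'i rel \<Rightarrow> ('i \<Rightarrow> 'a) \<Rightarrow> 'a \<Rightarrow> bool" where
  "pseudo_limit G val r a l \<longleftrightarrow>
     (\<exists>\<alpha>\<in>Field r. \<forall>i j.
        (\<alpha>, i) \<in> r - Id \<and> (i, j) \<in> r - Id \<longrightarrow>
        val (a i \<otimes>\<^bsub>G\<^esub> inv\<^bsub>G\<^esub> l) = val (a i \<otimes>\<^bsub>G\<^esub> inv\<^bsub>G\<^esub> a j))"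

text \<open>
  HOL cannot quantify over all index types inside a definition, so the type of the indices is a
  parameter. Nothing is lost for \<open>'i = 'a\<close>: the lemma \<open>pseudo_complete_all_index_types\<close> below
  shows that \<open>pseudo_complete TYPE('a)\<close> implies \<open>pseudo_complete TYPE('i)\<close> for every \<open>'i\<close>.
\<close>

definition pseudo_complete ::
  "'i itself \<Rightarrow> ('a, 'b) monoid_scheme \<Rightarrow> ('v, 'c) gorder_scheme \<Rightarrow> ('a \<Rightarrow> 'v) \<Rightarrow> bool" where
  "pseudo_complete (_ :: 'i itself) G \<Gamma> val \<longleftrightarrow>
     (\<forall>(r :: 'i rel) a. index_order r \<and> a ` Field r \<subseteq> carrier G \<and> pseudo_Cauchy G \<Gamma> val r a \<longrightarrow>
        (\<exists>l\<in>carrier G. pseudo_limit G val r a l))"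


section \<open>The induced valued group modulo \<open>m\<close>\<close>

definition multiples :: "('a, 'b) monoid_scheme \<Rightarrow> nat \<Rightarrow> 'a set" where
  "multiples G m = (\<lambda>g. g [^]\<^bsub>G\<^esub> m) ` carrier G"

definition V_mod ::
  "('a, 'b) monoid_scheme \<Rightarrow> ('v, 'c) gorder_scheme \<Rightarrow> ('a \<Rightarrow> 'v) \<Rightarrow> nat \<Rightarrow> 'a \<Rightarrow> 'a set" where
  "V_mod G \<Gamma> val m a =
     {x \<in> carrier G. \<forall>g\<in>carrier G. val (a \<otimes>\<^bsub>G\<^esub> g [^]\<^bsub>G\<^esub> m) \<sqsubset>\<^bsub>\<Gamma>\<^esub> val x}"

definition V_rel ::
  "('a, 'b) monoid_scheme \<Rightarrow> ('v, 'c) gorder_scheme \<Rightarrow> ('a \<Rightarrow> 'v) \<Rightarrow> nat \<Rightarrow> 'a rel" where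
  "V_rel G \<Gamma> val m =
     {(a, b). a \<in> carrier G \<and> b \<in> carrier G \<and> V_mod G \<Gamma> val m a = V_mod G \<Gamma> val m b}"

definition val_mod ::
  "('a, 'b) monoid_scheme \<Rightarrow> ('v, 'c) gorder_scheme \<Rightarrow> ('a \<Rightarrow> 'v) \<Rightarrow> nat \<Rightarrow> 'a \<Rightarrow> 'a set" where
  "val_mod G \<Gamma> val m a = V_rel G \<Gamma> val m `` {a}"

definition order_mod ::
  "('a, 'b) monoid_scheme \<Rightarrow> ('v, 'c) gorder_scheme \<Rightarrow> ('a \<Rightarrow> 'v) \<Rightarrow> nat \<Rightarrow> 'a set gorder" where
  "order_mod G \<Gamma> val m =
     \<lparr>carrier = carrier G // V_rel G \<Gamma> val m,
      eq = (=),
      le = (\<lambda>A B. A = B \<or> (\<exists>a\<in>A. \<exists>b\<in>B. V_mod G \<Gamma> val m b \<subset> V_mod G \<Gamma> val m a))\<rparr>"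

text \<open>
  The valuation on the quotient group: \<open>val_mod\<close> is constant on each coset of \<open>mG\<close>
  (see \<open>val_quot_coset\<close> below), and \<open>val_quot\<close> returns this constant value.
\<close>

definition val_quot ::
  "('a, 'b) monoid_scheme \<Rightarrow> ('v, 'c) gorder_scheme \<Rightarrow> ('a \<Rightarrow> 'v) \<Rightarrow> nat \<Rightarrow> 'a set \<Rightarrow> 'a set" where
  "val_quot G \<Gamma> val m C = the_elem (val_mod G \<Gamma> val m ` C)"


section \<open>Well-definedness\<close>

context valued_abelian_group
begin

lemma val_closed [simp, intro]: "g \<in> carrier G \<Longrightarrow> val g \<in> carrier \<Gamma>"
  using val_surj by blast

lemma less_iff: "x \<sqsubset>\<^bsub>\<Gamma>\<^esub> y \<longleftrightarrow> x \<sqsubseteq>\<^bsub>\<Gamma>\<^esub> y \<and> x \<noteq> y"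
  by (simp add: lless_def value_order.eq_is_equal)

lemma not_less_iff: "\<lbrakk>x \<in> carrier \<Gamma>; y \<in> carrier \<Gamma>\<rbrakk> \<Longrightarrow> \<not> x \<sqsubset>\<^bsub>\<Gamma>\<^esub> y \<longleftrightarrow> y \<sqsubseteq>\<^bsub>\<Gamma>\<^esub> x"
  using value_order.total_order_total value_order.weak_le_antisym value_order.le_refl
  by (auto simp: less_iff value_order.eq_is_equal)

lemma val_one: "val \<one> = infty"
  by (simp add: val_eq_infty_iff)

lemma val_le_one: "g \<in> carrier G \<Longrightarrow> val g \<sqsubseteq>\<^bsub>\<Gamma>\<^esub> val \<one>"
  using infty_greatest by (auto simp: val_one greatest_def)

lemma val_diff_ge:
  assumes "g \<in> carrier G" "h \<in> carrier G" "x \<in> carrier \<Gamma>"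
    "x \<sqsubseteq>\<^bsub>\<Gamma>\<^esub> val g" "x \<sqsubseteq>\<^bsub>\<Gamma>\<^esub> val h"
  shows "x \<sqsubseteq>\<^bsub>\<Gamma>\<^esub> val (g \<otimes> inv h)"
proof -
  have "(if val g \<sqsubseteq>\<^bsub>\<Gamma>\<^esub> val h then val g else val h) \<sqsubseteq>\<^bsub>\<Gamma>\<^esub> val (g \<otimes> inv h)"
    using val_diff assms by blast
  then show ?thesis
    using assms value_order.le_trans[of x _ "val (g \<otimes> inv h)"] by (auto split: if_splits)
qed

lemma subgroup_multiples: "subgroup (multiples G m) G"
proof
  show "multiples G m \<subseteq> carrier G"
    by (auto simp: multiples_def)
next
  fix x y assume "x \<in> multiples G m" "y \<in> multiples G m"
  then obtain g h where "g \<in> carrier G" "h \<in> carrier G" "x = g [^] m" "y = h [^] m"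
    by (auto simp: multiples_def)
  then have "x \<otimes> y = (g \<otimes> h) [^] m" "g \<otimes> h \<in> carrier G"
    by (auto simp: nat_pow_distrib)
  then show "x \<otimes> y \<in> multiples G m"
    by (auto simp: multiples_def)
next
  have "\<one> = \<one> [^] m"
    by simp
  then show "\<one> \<in> multiples G m"
    unfolding multiples_def by blast
next
  fix x assume "x \<in> multiples G m"
  then obtain g where "g \<in> carrier G" "x = g [^] m"
    by (auto simp: multiples_def)
  then have "inv x = (inv g) [^] m" "inv g \<in> carrier G"
    by (auto simp: nat_pow_inv)
  then show "inv x \<in> multiples G m"
    unfolding multiples_def by blast
qed

lemma normal_multiples: "multiples G m \<lhd> G"
  by (simp add: normal_iff_subgroup subgroup_multiples)

abbreviation "V \<equiv> V_mod G \<Gamma> val"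

lemma notin_V_iff:
  assumes "a \<in> carrier G" "x \<in> carrier G"
  shows "x \<notin> V m a \<longleftrightarrow> (\<exists>g\<in>carrier G. val x \<sqsubseteq>\<^bsub>\<Gamma>\<^esub> val (a \<otimes> g [^] m))"
  using assms not_less_iff by (auto simp: V_mod_def)

lemma V_subset: "V m a \<subseteq> carrier G"
  by (auto simp: V_mod_def)

lemma V_up:
  assumes "a \<in> carrier G" "x \<in> V m a" "y \<in> carrier G" "val x \<sqsubseteq>\<^bsub>\<Gamma>\<^esub> val y"
  shows "y \<in> V m a"
proof (rule ccontr)
  assume "y \<notin> V m a"
  then obtain g where g: "g \<in> carrier G" "val y \<sqsubseteq>\<^bsub>\<Gamma>\<^esub> val (a \<otimes> g [^] m)"
    using notin_V_iff assms by blast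
  have "x \<in> carrier G" using assms V_subset by blast
  then have "val x \<sqsubseteq>\<^bsub>\<Gamma>\<^esub> val (a \<otimes> g [^] m)"
    using value_order.le_trans[OF assms(4) g(2)] assms g by auto
  then show False
    using notin_V_iff[of a x m] assms g \<open>x \<in> carrier G\<close> by blast
qed

lemma V_linear:
  assumes "a \<in> carrier G" "b \<in> carrier G"
  shows "V m a \<subseteq> V m b \<or> V m b \<subseteq> V m a"
proof (rule ccontr)
  assume "\<not> ?thesis"
  then obtain x y where xy: "x \<in> V m a" "x \<notin> V m b" "y \<in> V m b" "y \<notin> V m a"
    by blast
  then have "x \<in> carrier G" "y \<in> carrier G" using V_subset by auto
  then show False
    using V_up[OF assms(1) xy(1), of y] V_up[OF assms(2) xy(3), of x] xy
      value_order.total_order_total[of "val x" "val y"] by auto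
qed

lemma V_diff:
  assumes "a \<in> carrier G" "b \<in> carrier G"
  shows "V m (a \<otimes> inv b) \<subseteq> V m a \<union> V m b"
proof
  fix x assume x: "x \<in> V m (a \<otimes> inv b)"
  then have xG: "x \<in> carrier G" using V_subset by blast
  show "x \<in> V m a \<union> V m b"
  proof (rule ccontr)
    assume "\<not> ?thesis"
    then have "x \<notin> V m a" "x \<notin> V m b" by simp_all
    then obtain g h where g: "g \<in> carrier G" "val x \<sqsubseteq>\<^bsub>\<Gamma>\<^esub> val (a \<otimes> g [^] m)"
      and h: "h \<in> carrier G" "val x \<sqsubseteq>\<^bsub>\<Gamma>\<^esub> val (b \<otimes> h [^] m)"
      unfolding notin_V_iff[OF assms(1) xG] notin_V_iff[OF assms(2) xG] by blast
    have "val x \<sqsubseteq>\<^bsub>\<Gamma>\<^esub> val ((a \<otimes> g [^] m) \<otimes> inv (b \<otimes> h [^] m))"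
      using val_diff_ge g h assms xG by auto
    also have "(a \<otimes> g [^] m) \<otimes> inv (b \<otimes> h [^] m) = (a \<otimes> inv b) \<otimes> (g \<otimes> inv h) [^] m"
      using assms g h by (simp add: inv_mult nat_pow_distrib nat_pow_inv m_ac)
    finally show False
      using x notin_V_iff[of "a \<otimes> inv b" x m] g h assms xG by auto
  qed
qed

lemma V_empty_iff:
  assumes "a \<in> carrier G"
  shows "V m a = {} \<longleftrightarrow> a \<in> multiples G m"
proof
  assume "V m a = {}"
  then obtain g where g: "g \<in> carrier G" "val \<one> \<sqsubseteq>\<^bsub>\<Gamma>\<^esub> val (a \<otimes> g [^] m)"
    using notin_V_iff[of a \<one> m] assms by auto
  then have "val (a \<otimes> g [^] m) = val \<one>"
    using val_le_one[of "a \<otimes> g [^] m"] assms value_order.weak_le_antisym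
    by (auto simp: value_order.eq_is_equal)
  then have "a \<otimes> g [^] m = \<one>"
    using val_eq_infty_iff[of "a \<otimes> g [^] m"] assms g by (simp add: val_one)
  then have "a = (inv g) [^] m"
    using assms g by (metis inv_equality inv_inv nat_pow_closed nat_pow_inv m_comm)
  then show "a \<in> multiples G m"
    using g unfolding multiples_def by blast
next
  assume "a \<in> multiples G m"
  then obtain g where g: "g \<in> carrier G" "a = g [^] m"
    by (auto simp: multiples_def)
  have "a \<otimes> (inv g) [^] m = \<one>"
    using g by (simp add: nat_pow_inv)
  then show "V m a = {}"
    using notin_V_iff[OF assms, of _ m] V_subset val_le_one g
    by (metis assms equals0I inv_closed subsetD)
qed

lemma V_one: "V m \<one> = {}"
  using V_empty_iff subgroup.one_closed[OF subgroup_multiples] by blast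

lemma equiv_V_rel: "equiv (carrier G) (V_rel G \<Gamma> val m)"
  by (auto simp: V_rel_def equiv_def refl_on_def sym_on_def trans_on_def)

lemma val_mod_eq_iff:
  "\<lbrakk>a \<in> carrier G; b \<in> carrier G\<rbrakk> \<Longrightarrow> val_mod G \<Gamma> val m a = val_mod G \<Gamma> val m b \<longleftrightarrow> V m a = V m b"
  unfolding val_mod_def by (subst eq_equiv_class_iff[OF equiv_V_rel]) (auto simp: V_rel_def)

lemma carrier_order_mod: "carrier (order_mod G \<Gamma> val m) = val_mod G \<Gamma> val m ` carrier G"
  by (auto simp: order_mod_def quotient_def val_mod_def)

lemma val_mod_le_iff:
  assumes "a \<in> carrier G" "b \<in> carrier G"
  shows "val_mod G \<Gamma> val m a \<sqsubseteq>\<^bsub>order_mod G \<Gamma> val m\<^esub> val_mod G \<Gamma> val m b \<longleftrightarrow> V m b \<subseteq> V m a"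
proof -
  have "(\<exists>a'\<in>val_mod G \<Gamma> val m a. \<exists>b'\<in>val_mod G \<Gamma> val m b. V m b' \<subset> V m a') \<longleftrightarrow> V m b \<subset> V m a"
    using assms by (auto simp: val_mod_def V_rel_def)
  then show ?thesis
    using val_mod_eq_iff[OF assms] by (auto simp: order_mod_def)
qed

lemma val_mod_less_iff:
  assumes "a \<in> carrier G" "b \<in> carrier G"
  shows "val_mod G \<Gamma> val m a \<sqsubset>\<^bsub>order_mod G \<Gamma> val m\<^esub> val_mod G \<Gamma> val m b \<longleftrightarrow> V m b \<subset> V m a"
  using val_mod_le_iff[OF assms, of m] val_mod_eq_iff[OF assms, of m]
  by (auto simp: lless_def order_mod_def)

lemma total_order_mod: "total_order (order_mod G \<Gamma> val m)" (is "total_order ?L")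
proof -
  have eq: "(.=\<^bsub>?L\<^esub>) = (=)" by (simp add: order_mod_def)
  show ?thesis
  proof (unfold_locales, goal_cases)
    case (5 x y)
    then show ?case unfolding carrier_order_mod eq
      by (elim imageE) (simp add: val_mod_le_iff val_mod_eq_iff)
  next
    case (6 x y z)
    then show ?case unfolding carrier_order_mod
      by (auto simp: val_mod_le_iff)
  next
    case (9 x y)
    then show ?case unfolding carrier_order_mod
      by (elim imageE) (simp add: val_mod_le_iff V_linear)
  qed (auto simp: eq carrier_order_mod val_mod_le_iff)
qed

lemma V_add_multiple:
  assumes "a \<in> carrier G" "c \<in> multiples G m"
  shows "V m (c \<otimes> a) = V m a"
proof -
  have c: "c \<in> carrier G" using assms subgroup.subset[OF subgroup_multiples] by blast
  have 1: "V m (x \<otimes> inv d) \<subseteq> V m x" if "x \<in> carrier G" "d \<in> multiples G m" for x d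
  proof -
    have "d \<in> carrier G" using that subgroup.subset[OF subgroup_multiples] by blast
    then show ?thesis using V_diff[of x d m] V_empty_iff[of d m] that by auto
  qed
  have "V m ((c \<otimes> a) \<otimes> inv c) \<subseteq> V m (c \<otimes> a)" "V m (a \<otimes> inv (inv c)) \<subseteq> V m a"
    using 1[of "c \<otimes> a" c] 1[of a "inv c"] assms c
    by (auto intro: subgroup.m_inv_closed[OF subgroup_multiples])
  moreover have "(c \<otimes> a) \<otimes> inv c = a" "a \<otimes> inv (inv c) = c \<otimes> a"
    using assms c by (auto simp: m_ac r_inv)
  ultimately show ?thesis by auto
qed

lemma val_quot_coset:
  assumes "a \<in> carrier G"
  shows "val_quot G \<Gamma> val m (multiples G m #> a) = val_mod G \<Gamma> val m a"
proof -
  have sub: "multiples G m \<subseteq> carrier G"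
    using subgroup.subset[OF subgroup_multiples] .
  have "val_mod G \<Gamma> val m x = val_mod G \<Gamma> val m a" if "x \<in> multiples G m #> a" for x
  proof -
    obtain c where c: "c \<in> multiples G m" "x = c \<otimes> a"
      using \<open>x \<in> multiples G m #> a\<close> by (auto simp: r_coset_def)
    then have "c \<otimes> a \<in> carrier G" using assms sub by auto
    then show ?thesis using val_mod_eq_iff V_add_multiple c assms by simp
  qed
  moreover have "a \<in> multiples G m #> a"
    using assms subgroup_multiples by (simp add: rcos_self)
  ultimately have "val_mod G \<Gamma> val m ` (multiples G m #> a) = {val_mod G \<Gamma> val m a}"
    by blast
  then show ?thesis by (simp add: val_quot_def)
qed

lemma val_mod_one: "val_mod G \<Gamma> val m \<one> = multiples G m"
proof -
  have "val_mod G \<Gamma> val m \<one> = {b \<in> carrier G. V m b = {}}"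
    by (auto simp: val_mod_def V_rel_def V_one)
  then show ?thesis
    using V_empty_iff[of _ m] subgroup.subset[OF subgroup_multiples, of m] by blast
qed

theorem induced_valued_abelian_group:
  "valued_abelian_group (G Mod multiples G m) (order_mod G \<Gamma> val m)
     (multiples G m) (val_quot G \<Gamma> val m)"
proof -
  let ?Q = "G Mod multiples G m" and ?L = "order_mod G \<Gamma> val m"
  let ?w = "val_quot G \<Gamma> val m" and ?p = "\<lambda>a. multiples G m #> a"
  have car: "carrier ?Q = ?p ` carrier G"
    by (simp add: carrier_FactGroup)
  interpret N: normal "multiples G m" G by (rule normal_multiples)
  interpret L: total_order ?L by (rule total_order_mod)
  have diff: "?p a \<otimes>\<^bsub>?Q\<^esub> inv\<^bsub>?Q\<^esub> ?p b = ?p (a \<otimes> inv b)"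
    if "a \<in> carrier G" "b \<in> carrier G" for a b
    using that car by (simp add: N.inv_FactGroup N.rcos_inv N.rcos_sum)
  have "comm_group ?Q"
    by (simp add: abelian_FactGroup subgroup_multiples)
  moreover have "valued_abelian_group_axioms ?Q ?L (multiples G m) ?w"
  proof
    show "?w ` carrier ?Q = carrier ?L"
      by (simp add: car carrier_order_mod image_image val_quot_coset)
    show "greatest ?L (multiples G m) (carrier ?L)"
      unfolding greatest_def carrier_order_mod val_mod_one[symmetric, of m]
      by (auto simp: val_mod_le_iff V_one)
  next
    fix g assume "g \<in> carrier ?Q"
    then obtain a where a: "a \<in> carrier G" "g = ?p a" using car by blast
    have "?w g = multiples G m \<longleftrightarrow> V m a = {}"
      using a val_mod_eq_iff[of a \<one> m] by (simp add: val_quot_coset val_mod_one V_one)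
    also have "\<dots> \<longleftrightarrow> ?p a = multiples G m"
      using a V_empty_iff coset_join1 coset_join2 subgroup_multiples subgroup.subset
      by metis
    finally show "?w g = multiples G m \<longleftrightarrow> g = \<one>\<^bsub>?Q\<^esub>"
      using a by simp
  next
    fix g h assume "g \<in> carrier ?Q" "h \<in> carrier ?Q"
    then obtain a b where ab: "a \<in> carrier G" "b \<in> carrier G" "g = ?p a" "h = ?p b"
      unfolding car by (elim imageE)
    show "(if ?w g \<sqsubseteq>\<^bsub>?L\<^esub> ?w h then ?w g else ?w h) \<sqsubseteq>\<^bsub>?L\<^esub> ?w (g \<otimes>\<^bsub>?Q\<^esub> inv\<^bsub>?Q\<^esub> h)"
      unfolding ab diff[OF ab(1,2)]
      using ab(1,2) V_diff[of a b m] V_linear[of a b m]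
      by (cases "V m b \<subseteq> V m a") (auto simp: val_quot_coset val_mod_le_iff)
  qed
  ultimately show ?thesis
    by (simp add: valued_abelian_group_def total_order_mod)
qed

end

text \<open>
  A tail of a pseudo-Cauchy sequence is injective, so its index set can be replaced by a subset
  of the group.
\<close>

theorem (in valued_abelian_group) pseudo_complete_all_index_types:
  assumes pc: "pseudo_complete TYPE('a) G \<Gamma> val"
  shows "pseudo_complete TYPE('i) G \<Gamma> val"
  unfolding pseudo_complete_def
proof (intro allI impI, elim conjE)
  fix r :: "'i rel" and a
  assume io: "index_order r" and aG: "a ` Field r \<subseteq> carrier G" and "pseudo_Cauchy G \<Gamma> val r a"
  then obtain \<alpha> where \<alpha>: "\<alpha> \<in> Field r" and cau: "\<And>i j k.
        (\<alpha>, i) \<in> r - Id \<Longrightarrow> (i, j) \<in> r - Id \<Longrightarrow> (j, k) \<in> r - Id \<Longrightarrow>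
        val (a i \<otimes> inv a j) \<sqsubset>\<^bsub>\<Gamma>\<^esub> val (a j \<otimes> inv a k)"
    unfolding pseudo_Cauchy_def by blast
  have wo: "Well_order r" and nomax: "\<And>i. i \<in> Field r \<Longrightarrow> \<exists>j. (i, j) \<in> r - Id"
    using io by (auto simp: index_order_def)
  have refl: "(i, i) \<in> r" if "i \<in> Field r" for i
    using wo that by (simp add: order_on_defs refl_on_def)
  have "antisym r" "trans r" "total_on (Field r) r" and wfr: "wf (r - Id)"
    using wo by (simp_all add: order_on_defs)
  then have antisym: "\<And>i j. (i, j) \<in> r \<Longrightarrow> (j, i) \<in> r \<Longrightarrow> i = j"
    and trans: "\<And>i j k. (i, j) \<in> r \<Longrightarrow> (j, k) \<in> r \<Longrightarrow> (i, k) \<in> r"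
    and total: "\<And>i j. i \<in> Field r \<Longrightarrow> j \<in> Field r \<Longrightarrow> i \<noteq> j \<Longrightarrow> (i, j) \<in> r \<or> (j, i) \<in> r"
    by (auto dest: antisymD transD simp: total_on_def)
  define T where "T = {i. (\<alpha>, i) \<in> r - Id}"
  have TF: "T \<subseteq> Field r" by (auto simp: T_def Field_def)
  have Tup: "j \<in> T" if "i \<in> T" "(i, j) \<in> r" for i j
    using that trans[of \<alpha> i j] antisym[of \<alpha> i] unfolding T_def by auto
  have ne: "a i \<noteq> a j" if "i \<in> T" "(i, j) \<in> r - Id" for i j
  proof
    assume eq: "a i = a j"
    have F: "i \<in> Field r" "j \<in> Field r" using that by (auto simp: Field_def)
    obtain k where k: "(j, k) \<in> r - Id" using nomax F by blast
    then have "k \<in> Field r" by (auto simp: Field_def)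
    then have G: "a i \<in> carrier G" "a j \<in> carrier G" "a k \<in> carrier G" using aG F by auto
    have "val \<one> \<sqsubset>\<^bsub>\<Gamma>\<^esub> val (a j \<otimes> inv a k)"
      using cau[OF _ that(2) k] that(1) eq G by (simp add: T_def)
    then show False
      using not_less_iff[of "val \<one>" "val (a j \<otimes> inv a k)"] val_le_one[of "a j \<otimes> inv a k"] G
      by auto
  qed
  have inj: "inj_on a T"
  proof (rule inj_onI)
    fix i j assume "i \<in> T" "j \<in> T" "a i = a j"
    then show "i = j" using ne[of i j] ne[of j i] total[of i j] TF by auto
  qed
  define s where "s = {(a i, a j) | i j. i \<in> T \<and> (i, j) \<in> r}"
  define b where "b = inv_into T a"
  have b: "b (a i) = i" if "i \<in> T" for i using that inj by (simp add: b_def)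
  have Fs: "Field s = a ` T"
  proof
    show "Field s \<subseteq> a ` T" using Tup by (auto simp: s_def Field_def)
    have "(a i, a i) \<in> s" if "i \<in> T" for i using that refl TF by (auto simp: s_def)
    then show "a ` T \<subseteq> Field s" by (auto intro: FieldI1)
  qed
  have s_iff: "(a i, a j) \<in> s \<longleftrightarrow> (i, j) \<in> r" if "i \<in> T" "j \<in> T" for i j
  proof
    assume "(a i, a j) \<in> s"
    then obtain i' j' where *: "a i = a i'" "a j = a j'" "i' \<in> T" "(i', j') \<in> r"
      by (auto simp: s_def)
    moreover have "j' \<in> T" using * Tup by simp
    ultimately show "(i, j) \<in> r" using that inj_onD[OF inj] by metis
  next
    assume "(i, j) \<in> r"
    then show "(a i, a j) \<in> s" using that by (auto simp: s_def)
  qed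
  have s_iff': "(a i, a j) \<in> s - Id \<longleftrightarrow> (i, j) \<in> r - Id" if "i \<in> T" "j \<in> T" for i j
    using s_iff[OF that] inj_on_eq_iff[OF inj that] by simp
  have s_F: "x \<in> a ` T" "y \<in> a ` T" if "(x, y) \<in> s" for x y
    using that Fs by (auto simp: Field_def)
  have "index_order s"
    unfolding index_order_def order_on_defs
  proof (intro conjI ballI)
    show "s \<subseteq> Field s \<times> Field s" by (auto simp: Field_def)
    show "refl_on (Field s) s"
      unfolding refl_on_def Fs using s_iff refl TF by auto
    show "trans s"
    proof (rule transI)
      fix x y z assume xyz: "(x, y) \<in> s" "(y, z) \<in> s"
      then obtain i j k where "i \<in> T" "j \<in> T" "k \<in> T" "x = a i" "y = a j" "z = a k"
        using s_F by (metis imageE)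
      then show "(x, z) \<in> s" using xyz s_iff trans[of i j k] by simp
    qed
    show "antisym s"
    proof (rule antisymI)
      fix x y assume xy: "(x, y) \<in> s" "(y, x) \<in> s"
      then obtain i j where "i \<in> T" "j \<in> T" "x = a i" "y = a j"
        using s_F by (metis imageE)
      then show "x = y" using xy s_iff antisym[of i j] by simp
    qed
    show "total_on (Field s) s"
      unfolding total_on_def Fs
    proof (intro ballI impI)
      fix x y assume "x \<in> a ` T" "y \<in> a ` T" "x \<noteq> y"
      then obtain i j where "i \<in> T" "j \<in> T" "x = a i" "y = a j" "i \<noteq> j" by blast
      then show "(x, y) \<in> s \<or> (y, x) \<in> s" using s_iff total[of i j] TF by auto
    qed
    have "s - Id \<subseteq> inv_image (r - Id) b"
    proof (clarsimp simp: inv_image_def)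
      fix x y assume "(x, y) \<in> s" "x \<noteq> y"
      moreover then obtain i j where "i \<in> T" "j \<in> T" "x = a i" "y = a j"
        using s_F by (metis imageE)
      ultimately show "(b x, b y) \<in> r \<and> b x \<noteq> b y" using s_iff b by auto
    qed
    then show "wf (s - Id)" using wf_inv_image[OF wfr] wf_subset by blast
    fix x assume "x \<in> Field s"
    then obtain i where i: "i \<in> T" "x = a i" using Fs by blast
    then obtain j where j: "(i, j) \<in> r - Id" using nomax TF by blast
    then have "j \<in> T" using i Tup by blast
    then show "\<exists>y. (x, y) \<in> s - Id" using s_iff' i j by blast
  qed
  moreover have "id ` Field s \<subseteq> carrier G" using Fs TF aG by auto
  moreover have "pseudo_Cauchy G \<Gamma> val s id"
  proof -
    obtain i0 where i0: "(\<alpha>, i0) \<in> r - Id" using nomax \<alpha> by blast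
    then have "i0 \<in> T" by (simp add: T_def)
    then have a0: "a i0 \<in> Field s" using Fs by simp
    have "val (id x \<otimes> inv id y) \<sqsubset>\<^bsub>\<Gamma>\<^esub> val (id y \<otimes> inv id z)"
      if "(x, y) \<in> s - Id" "(y, z) \<in> s - Id" for x y z
    proof -
      have "x \<in> a ` T" "y \<in> a ` T" "z \<in> a ` T" using s_F[of x y] s_F[of y z] that by simp_all
      then obtain i j k where *: "i \<in> T" "j \<in> T" "k \<in> T" "x = a i" "y = a j" "z = a k"
        by (elim imageE)
      have "(\<alpha>, i) \<in> r - Id" using * by (simp add: T_def)
      moreover have "(i, j) \<in> r - Id" "(j, k) \<in> r - Id"
        using that s_iff' * by simp_all
      ultimately show ?thesis using cau[of i j k] * by simp
    qed
    then show ?thesis unfolding pseudo_Cauchy_def using a0 by blast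
  qed
  ultimately obtain l where l: "l \<in> carrier G" "pseudo_limit G val s id l"
    using pc unfolding pseudo_complete_def by blast
  then obtain x where x: "x \<in> Field s" and lim: "\<And>y z. (x, y) \<in> s - Id \<Longrightarrow> (y, z) \<in> s - Id \<Longrightarrow>
     val (y \<otimes> inv l) = val (y \<otimes> inv z)"
    unfolding pseudo_limit_def by auto
  obtain k where k: "k \<in> T" "x = a k" using x Fs by blast
  have "val (a i \<otimes> inv l) = val (a i \<otimes> inv a j)" if "(k, i) \<in> r - Id" "(i, j) \<in> r - Id" for i j
  proof -
    have ij: "i \<in> T" using that(1) k Tup by simp
    moreover have "j \<in> T" using that(2) ij Tup by simp
    ultimately show ?thesis using lim[of "a i" "a j"] s_iff'[of k i] s_iff'[of i j] that k by simp
  qed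
  then have "pseudo_limit G val r a l"
    unfolding pseudo_limit_def using k TF by blast
  then show "\<exists>l\<in>carrier G. pseudo_limit G val r a l" using l by blast
qed

end

theory Submission
  imports Defs
begin

text \<open>
  Every coset \<open>a + mG\<close> contains an element of largest value \<open>max_val a\<close>: otherwise a well-ordered
  cofinal family of values \<open>val (a + m g\<^sub>i)\<close> makes \<open>(g\<^sub>i)\<close> pseudo-Cauchy, by \<open>\<int>\<close>-invariance, and a
  pseudo-limit \<open>g\<close> gives \<open>val (a + m g)\<close> above all of them. Hence the induced valuation of the
  coset of \<open>a\<close> is equivalent to \<open>max_val a\<close>. A pseudo-Cauchy sequence of cosets
  \<open>a\<^sub>i + mG\<close> with values \<open>\<gamma>\<^sub>i\<close> is lifted by transfinite recursion to \<open>b\<^sub>i \<in> a\<^sub>i + mG\<close>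
  with \<open>val (b\<^sub>i - b\<^sub>j) = \<gamma>\<^sub>i\<close> for \<open>i < j\<close>: the balls of radius \<open>\<gamma>\<^sub>i\<close> around \<open>b\<^sub>i\<close>, \<open>i < j\<close>, have a
  common point \<open>b\<close>, and \<open>b\<^sub>j\<close> is an element of \<open>a\<^sub>j + mG\<close> closest to \<open>b\<close>. The coset of a
  pseudo-limit of the lift is a pseudo-limit of the given sequence.
\<close>

text \<open>Turns a subset without last element into an index set of its own, so that
  pseudo-completeness applies to sequences given only there.\<close>

lemma index_order_Restr:
  assumes r: "Well_order r" and A: "A \<subseteq> Field r"
    and nomax: "\<And>i. i \<in> A \<Longrightarrow> \<exists>j\<in>A. (i, j) \<in> r - Id"
  shows "index_order (Restr r A)" and "Field (Restr r A) = A"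
proof -
  show F: "Field (Restr r A) = A"
    using Refl_Field_Restr2[OF _ A] r by (simp add: order_on_defs)
  show "index_order (Restr r A)"
    using Well_order_Restr[OF r, of A] nomax A by (fastforce simp: index_order_def F)
qed

section \<open>Ultrametric arithmetic and intersections of balls\<close>

context valued_abelian_group
begin

lemma val_inv:
  assumes "g \<in> carrier G"
  shows "val (inv g) = val g"
proof -
  \<comment> \<open>As a difference from \<open>\<one>\<close>, whose value is greatest,
    \<open>inv x\<close> loses no value; inversion being an involution, this yields both
    inequalities.\<close>
  have le: "val x \<sqsubseteq>\<^bsub>\<Gamma>\<^esub> val (inv x)" if "x \<in> carrier G" for x
    using val_diff_ge[of \<one> x "val x"] that val_le_one[of x] by simp
  have "val (inv g) \<sqsubseteq>\<^bsub>\<Gamma>\<^esub> val (inv (inv g))"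
    using assms by (intro le) simp
  then show ?thesis
    using le[OF assms] assms value_order.weak_le_antisym
    by (auto simp: value_order.eq_is_equal)
qed

lemma val_mult_ge:
  assumes "g \<in> carrier G" "h \<in> carrier G" "x \<in> carrier \<Gamma>"
    "x \<sqsubseteq>\<^bsub>\<Gamma>\<^esub> val g" "x \<sqsubseteq>\<^bsub>\<Gamma>\<^esub> val h"
  shows "x \<sqsubseteq>\<^bsub>\<Gamma>\<^esub> val (g \<otimes> h)"
  using val_diff_ge[of g "inv h" x] assms by (simp add: val_inv)

lemma less_trans_le:
  assumes "x \<in> carrier \<Gamma>" "y \<in> carrier \<Gamma>" "z \<in> carrier \<Gamma>" "x \<sqsubset>\<^bsub>\<Gamma>\<^esub> y" "y \<sqsubseteq>\<^bsub>\<Gamma>\<^esub> z"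
  shows "x \<sqsubset>\<^bsub>\<Gamma>\<^esub> z"
  using assms value_order.weak_le_antisym[of x y] value_order.le_trans[of x y z]
  by (auto simp: less_iff value_order.eq_is_equal)

lemma le_trans_less:
  assumes "x \<in> carrier \<Gamma>" "y \<in> carrier \<Gamma>" "z \<in> carrier \<Gamma>" "x \<sqsubseteq>\<^bsub>\<Gamma>\<^esub> y" "y \<sqsubset>\<^bsub>\<Gamma>\<^esub> z"
  shows "x \<sqsubset>\<^bsub>\<Gamma>\<^esub> z"
  using assms value_order.weak_le_antisym[of y z] value_order.le_trans[of x y z]
  by (auto simp: less_iff value_order.eq_is_equal)

text \<open>Otherwise \<open>g\<close>, the difference of \<open>g \<otimes> h\<close> and
  \<open>h\<close>, would have a value strictly above its own.\<close>

lemma val_mult_eq: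
  assumes g: "g \<in> carrier G" and h: "h \<in> carrier G" and less: "val g \<sqsubset>\<^bsub>\<Gamma>\<^esub> val h"
  shows "val (g \<otimes> h) = val g"
proof -
  have "val g \<sqsubseteq>\<^bsub>\<Gamma>\<^esub> val (g \<otimes> h)"
    using val_mult_ge[of g h "val g"] g h less by (simp add: less_iff)
  moreover have "\<not> val g \<sqsubset>\<^bsub>\<Gamma>\<^esub> val (g \<otimes> h)"
  proof
    assume *: "val g \<sqsubset>\<^bsub>\<Gamma>\<^esub> val (g \<otimes> h)"
    have gh: "(g \<otimes> h) \<otimes> inv h = g"
      using g h by (simp add: m_assoc)
    have "(if val (g \<otimes> h) \<sqsubseteq>\<^bsub>\<Gamma>\<^esub> val h then val (g \<otimes> h) else val h) \<sqsubseteq>\<^bsub>\<Gamma>\<^esub> val g"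
      using val_diff[of "g \<otimes> h" h] g h gh by simp
    then have "val (g \<otimes> h) \<sqsubseteq>\<^bsub>\<Gamma>\<^esub> val g \<or> val h \<sqsubseteq>\<^bsub>\<Gamma>\<^esub> val g"
      by (auto split: if_splits)
    then show False
      using * less g h not_less_iff[of "val g" "val (g \<otimes> h)"] not_less_iff[of "val g" "val h"]
      by auto
  qed
  ultimately show ?thesis by (auto simp: less_iff)
qed

lemma mult_diff:
  assumes "x \<in> carrier G" "y \<in> carrier G" "z \<in> carrier G"
  shows "(x \<otimes> inv y) \<otimes> (y \<otimes> inv z) = x \<otimes> inv z"
proof -
  have "inv y \<otimes> (y \<otimes> inv z) = (inv y \<otimes> y) \<otimes> inv z"
    using assms m_assoc[of "inv y" y "inv z"] by simp
  then show ?thesis using assms by (simp add: m_assoc)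
qed

lemma val_diff_commute:
  assumes "x \<in> carrier G" "y \<in> carrier G"
  shows "val (x \<otimes> inv y) = val (y \<otimes> inv x)"
  using val_inv[of "x \<otimes> inv y"] assms by (simp add: inv_mult_group)

text \<open>
  The form of pseudo-completeness used below (the balls of radius \<open>\<gamma> i\<close> around \<open>c i\<close> meet)
  makes no distinction between the index sets with and without a maximum.
\<close>

lemma pseudo_complete_balls:
  fixes r :: "'i rel"
  assumes pc: "pseudo_complete TYPE('i) G \<Gamma> val"
    and r: "Well_order r" and A: "A \<subseteq> Field r"
    and c: "\<And>i. i \<in> A \<Longrightarrow> c i \<in> carrier G"
    and \<gamma>: "\<And>i. i \<in> A \<Longrightarrow> \<gamma> i \<in> carrier \<Gamma>"
    and val_c: "\<And>i j. \<lbrakk>i \<in> A; j \<in> A; (i, j) \<in> r - Id\<rbrakk> \<Longrightarrow> val (c i \<otimes> inv c j) = \<gamma> i"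
    and mono: "\<And>i j. \<lbrakk>i \<in> A; j \<in> A; (i, j) \<in> r - Id\<rbrakk> \<Longrightarrow> \<gamma> i \<sqsubset>\<^bsub>\<Gamma>\<^esub> \<gamma> j"
  shows "\<exists>b\<in>carrier G. \<forall>i\<in>A. \<gamma> i \<sqsubseteq>\<^bsub>\<Gamma>\<^esub> val (c i \<otimes> inv b)"
proof -
  have total: "\<And>i j. i \<in> Field r \<Longrightarrow> j \<in> Field r \<Longrightarrow> i \<noteq> j \<Longrightarrow> (i, j) \<in> r \<or> (j, i) \<in> r"
    and refl: "\<And>i. i \<in> Field r \<Longrightarrow> (i, i) \<in> r"
    and trans: "\<And>i j k. (i, j) \<in> r \<Longrightarrow> (j, k) \<in> r \<Longrightarrow> (i, k) \<in> r"
    and antisym: "\<And>i j. (i, j) \<in> r \<Longrightarrow> (j, i) \<in> r \<Longrightarrow> i = j"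
    using r by (auto simp: order_on_defs total_on_def refl_on_def dest: transD antisymD)
  \<comment> \<open>A last index \<open>k\<close> gives the common point \<open>c k\<close> at once;
    a pseudo-limit is taken only when there is no last index, as index sets have none.\<close>
  consider "A = {}" | k where "k \<in> A" "\<And>j. j \<in> A \<Longrightarrow> (k, j) \<notin> r - Id"
    | "A \<noteq> {}" "\<And>i. i \<in> A \<Longrightarrow> \<exists>j\<in>A. (i, j) \<in> r - Id"
    by blast
  then show ?thesis
  proof cases
    case 1
    then show ?thesis by auto
  next
    case 2
    have "\<gamma> i \<sqsubseteq>\<^bsub>\<Gamma>\<^esub> val (c i \<otimes> inv c k)" if i: "i \<in> A" for i
    proof (cases "i = k")
      case True
      then show ?thesis
        using \<gamma>[OF i] c[OF i] infty_greatest by (simp add: val_one greatest_def)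
    next
      case False
      then have "(i, k) \<in> r - Id"
        using total[of i k] 2 i A by auto
      then show ?thesis using val_c[OF i 2(1)] \<gamma>[OF i] by simp
    qed
    then show ?thesis using c[OF 2(1)] by blast
  next
    case 3
    let ?s = "Restr r A"
    have F: "Field ?s = A" and io: "index_order ?s"
      using index_order_Restr[OF r A 3(2)] by auto
    have "pseudo_Cauchy G \<Gamma> val ?s c"
    proof -
      obtain \<alpha> where "\<alpha> \<in> A" using 3 by blast
      moreover have "val (c i \<otimes> inv c j) \<sqsubset>\<^bsub>\<Gamma>\<^esub> val (c j \<otimes> inv c k)"
        if "(i, j) \<in> ?s - Id" "(j, k) \<in> ?s - Id" for i j k
        using that mono[of i j] val_c[of i j] val_c[of j k] by auto
      ultimately show ?thesis unfolding pseudo_Cauchy_def F by blast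
    qed
    moreover have "c ` Field ?s \<subseteq> carrier G" using c F by auto
    ultimately obtain b where b: "b \<in> carrier G" "pseudo_limit G val ?s c b"
      using pc io unfolding pseudo_complete_def by blast
    then obtain \<beta> where \<beta>: "\<beta> \<in> A" and lim:
      "\<And>i j. \<lbrakk>(\<beta>, i) \<in> ?s - Id; (i, j) \<in> ?s - Id\<rbrakk> \<Longrightarrow> val (c i \<otimes> inv b) = val (c i \<otimes> inv c j)"
      unfolding pseudo_limit_def F by blast
    have tail: "val (c i \<otimes> inv b) = \<gamma> i" if i: "i \<in> A" "(\<beta>, i) \<in> r - Id" for i
    proof -
      obtain j where "j \<in> A" "(i, j) \<in> r - Id" using 3 i by blast
      then show ?thesis using lim[of i j] val_c[of i j] i \<beta> by auto
    qed
    have "\<gamma> i \<sqsubseteq>\<^bsub>\<Gamma>\<^esub> val (c i \<otimes> inv b)" if i: "i \<in> A" for i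
    proof (cases "(\<beta>, i) \<in> r - Id")
      case True
      then show ?thesis using tail[OF i] \<gamma>[OF i] by simp
    next
      case False
      then have i\<beta>: "(i, \<beta>) \<in> r" using total[of i \<beta>] refl[of i] i \<beta> A by auto
      \<comment> \<open>The pseudo-limit controls only indices beyond \<open>\<beta>\<close>; any
        other \<open>i\<close> is compared with \<open>b\<close> through \<open>c k\<close> for some
        \<open>k\<close> beyond \<open>\<beta>\<close>.\<close>
      obtain k where k: "k \<in> A" "(\<beta>, k) \<in> r - Id" using 3 \<beta> by blast
      have ik: "(i, k) \<in> r - Id"
        using trans[OF i\<beta>, of k] k i\<beta> antisym[of \<beta> i] by auto
      have "\<gamma> i \<sqsubseteq>\<^bsub>\<Gamma>\<^esub> val ((c i \<otimes> inv c k) \<otimes> (c k \<otimes> inv b))"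
        using val_c[OF i k(1) ik] tail[OF k] mono[OF i k(1) ik] \<gamma>[OF i] c[OF i] c[OF k(1)] b(1)
        by - (rule val_mult_ge, auto simp: less_iff)
      then show ?thesis using mult_diff c[OF i] c[OF k(1)] b(1) by simp
    qed
    then show ?thesis using b(1) by blast
  qed
qed

end

section \<open>Largest values in cosets of the multiples of \<open>m\<close>\<close>

locale mod_valued_group = valued_abelian_group G \<Gamma> infty val
  for G :: "('a, 'b) monoid_scheme" (structure)
  and \<Gamma> :: "('v, 'c) gorder_scheme"
  and infty :: 'v and val :: "'a \<Rightarrow> 'v" +
  fixes m :: nat
  assumes m_pos: "m > 0" and Z_inv: "Z_invariant G val"
    and complete: "pseudo_complete TYPE('a) G \<Gamma> val"
begin

lemma val_pow: "g \<in> carrier G \<Longrightarrow> val (g [^] m) = val g"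
  using Z_inv m_pos by (simp add: Z_invariant_def)

lemma coset_max:
  assumes a: "a \<in> carrier G"
  shows "\<exists>g\<in>carrier G. \<forall>h\<in>carrier G. val (a \<otimes> h [^] m) \<sqsubseteq>\<^bsub>\<Gamma>\<^esub> val (a \<otimes> g [^] m)"
proof (rule ccontr)
  assume contra: "\<not> ?thesis"
  define v where "v g = val (a \<otimes> g [^] m)" for g
  have v_car: "v g \<in> carrier \<Gamma>" if "g \<in> carrier G" for g
    using that a by (simp add: v_def)
  have nomax: "\<exists>h\<in>carrier G. v g \<sqsubset>\<^bsub>\<Gamma>\<^esub> v h" if "g \<in> carrier G" for g
  proof -
    obtain h where "h \<in> carrier G" "\<not> v h \<sqsubseteq>\<^bsub>\<Gamma>\<^esub> v g"
      using contra \<open>g \<in> carrier G\<close> unfolding v_def by blast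
    then show ?thesis
      using not_less_iff[of "v g" "v h"] v_car that by blast
  qed
  \<comment> \<open>Group elements index themselves, so \<open>complete\<close> applies without a
    change of index type.\<close>
  obtain r :: "'a rel" where r: "well_order_on UNIV r"
    using well_order_on by blast
  then have F: "Field r = UNIV" and wo: "Well_order r"
    using well_order_on_Well_order by auto
  have wf: "wf (r - Id)" and total: "\<And>i j. i \<noteq> j \<Longrightarrow> (i, j) \<in> r \<or> (j, i) \<in> r"
    using r by (auto simp: order_on_defs total_on_def)
  \<comment> \<open>The records of \<open>v\<close> along an arbitrary well-order of the group form a well-ordered
    cofinal sequence.\<close>
  define C where "C = {g \<in> carrier G. \<forall>h\<in>carrier G. (h, g) \<in> r - Id \<longrightarrow> v h \<sqsubset>\<^bsub>\<Gamma>\<^esub> v g}"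
  have CG: "C \<subseteq> carrier G" by (auto simp: C_def)
  have mono: "v i \<sqsubset>\<^bsub>\<Gamma>\<^esub> v j" if "i \<in> C" "j \<in> C" "(i, j) \<in> r - Id" for i j
    using that unfolding C_def by blast
  have cofinal: "\<exists>g\<in>C. v h \<sqsubseteq>\<^bsub>\<Gamma>\<^esub> v g" if h: "h \<in> carrier G" for h
  proof -
    let ?Q = "{g \<in> carrier G. v h \<sqsubseteq>\<^bsub>\<Gamma>\<^esub> v g}"
    have hQ: "h \<in> ?Q" using h v_car by simp
    \<comment> \<open>The first element that reaches \<open>v h\<close> is a record: all earlier
      ones stay strictly below \<open>v h\<close>.\<close>
    obtain g where g: "g \<in> ?Q" and least: "\<And>y. (y, g) \<in> r - Id \<Longrightarrow> y \<notin> ?Q"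
      by (rule wfE_min[OF wf hQ], rule that)
    have "v y \<sqsubset>\<^bsub>\<Gamma>\<^esub> v g" if y: "y \<in> carrier G" "(y, g) \<in> r - Id" for y
    proof -
      have "v y \<sqsubset>\<^bsub>\<Gamma>\<^esub> v h"
        using least[OF y(2)] y(1) not_less_iff[of "v y" "v h"] v_car h by blast
      then show ?thesis
        using less_trans_le[of "v y" "v h" "v g"] v_car y(1) h g by simp
    qed
    then show ?thesis using g unfolding C_def by blast
  qed
  have "\<exists>b\<in>carrier G. \<forall>i\<in>C. v i \<sqsubseteq>\<^bsub>\<Gamma>\<^esub> val (i \<otimes> inv b)"
  proof (rule pseudo_complete_balls[OF complete wo])
    fix i j assume ij: "i \<in> C" "j \<in> C" "(i, j) \<in> r - Id"
    then have G: "i \<in> carrier G" "j \<in> carrier G" using CG by auto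
    \<comment> \<open>Invariance enters here: \<open>i \<otimes> inv j\<close> has the value of its
      \<open>m\<close>-th power, a difference of two coset elements with values \<open>v i\<close>
      and \<open>v j\<close>, the first being smaller.\<close>
    have "val (i \<otimes> inv j) = val ((i \<otimes> inv j) [^] m)"
      using G val_pow by simp
    also have "(i \<otimes> inv j) [^] m = (a \<otimes> i [^] m) \<otimes> inv (a \<otimes> j [^] m)"
    proof -
      have "(a \<otimes> i [^] m) \<otimes> inv (a \<otimes> j [^] m) = (i [^] m \<otimes> inv (inv a)) \<otimes> (inv a \<otimes> inv (j [^] m))"
        using G a by (simp add: inv_mult m_comm)
      also have "\<dots> = i [^] m \<otimes> inv (j [^] m)"
        using G a by (intro mult_diff) auto
      finally show ?thesis using G by (simp add: nat_pow_distrib nat_pow_inv)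
    qed
    also have "val \<dots> = v i"
      using val_mult_eq[of "a \<otimes> i [^] m" "inv (a \<otimes> j [^] m)"] mono[OF ij] G a
      by (simp add: v_def val_inv)
    finally show "val (i \<otimes> inv j) = v i" .
  qed (use mono v_car CG F in auto)
  then obtain b where b: "b \<in> carrier G" and vb: "\<And>i. i \<in> C \<Longrightarrow> v i \<sqsubseteq>\<^bsub>\<Gamma>\<^esub> val (i \<otimes> inv b)"
    by blast
  have Cb: "v i \<sqsubseteq>\<^bsub>\<Gamma>\<^esub> v b" if i: "i \<in> C" for i
  proof -
    have iG: "i \<in> carrier G" using i CG by blast
    \<comment> \<open>Passing from \<open>i\<close> to \<open>b\<close> changes the coset element by
      the \<open>m\<close>-th power of \<open>i \<otimes> inv b\<close>, whose value is at least
      \<open>v i\<close> by invariance.\<close>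
    have "v i \<sqsubseteq>\<^bsub>\<Gamma>\<^esub> val ((a \<otimes> i [^] m) \<otimes> inv ((i \<otimes> inv b) [^] m))"
      using iG a b vb[OF i] v_car[OF iG] by (intro val_diff_ge) (auto simp: v_def val_pow)
    also have "(a \<otimes> i [^] m) \<otimes> inv ((i \<otimes> inv b) [^] m)
        = (a \<otimes> inv (inv (i [^] m))) \<otimes> (inv (i [^] m) \<otimes> inv (inv (b [^] m)))"
      using iG a b by (simp add: nat_pow_distrib nat_pow_inv inv_mult)
    also have "\<dots> = a \<otimes> b [^] m"
      using iG a b mult_diff[of a "inv (i [^] m)" "inv (b [^] m)"] by simp
    finally show ?thesis by (simp add: v_def)
  qed
  \<comment> \<open>By cofinality \<open>v b\<close> would bound all values of \<open>v\<close>,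
    against \<open>nomax\<close>.\<close>
  obtain h where h: "h \<in> carrier G" "v b \<sqsubset>\<^bsub>\<Gamma>\<^esub> v h" using nomax[OF b] by blast
  obtain g where g: "g \<in> C" "v h \<sqsubseteq>\<^bsub>\<Gamma>\<^esub> v g" using cofinal[OF h(1)] by blast
  have "v b \<sqsubset>\<^bsub>\<Gamma>\<^esub> v g"
    using less_trans_le[of "v b" "v h" "v g"] h g b CG v_car by blast
  then show False
    using Cb[OF g(1)] not_less_iff[of "v b" "v g"] v_car b g(1) CG by blast
qed

section \<open>The induced valuation expressed through \<open>max_val\<close>\<close>

definition best :: "'a \<Rightarrow> 'a" where
  "best a = (SOME g. g \<in> carrier G \<and>
     (\<forall>h\<in>carrier G. val (a \<otimes> h [^] m) \<sqsubseteq>\<^bsub>\<Gamma>\<^esub> val (a \<otimes> g [^] m)))"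

text \<open>The optimal coset element is \<open>a \<otimes> best a [^] m\<close>, not
  \<open>best a\<close>: the choice concerns only the root of the added multiple.\<close>

definition max_val :: "'a \<Rightarrow> 'v" where
  "max_val a = val (a \<otimes> best a [^] m)"

lemma
  assumes "a \<in> carrier G"
  shows best_closed: "best a \<in> carrier G"
    and val_le_max_val: "h \<in> carrier G \<Longrightarrow> val (a \<otimes> h [^] m) \<sqsubseteq>\<^bsub>\<Gamma>\<^esub> max_val a"
proof -
  have "\<exists>g. g \<in> carrier G \<and> (\<forall>h\<in>carrier G. val (a \<otimes> h [^] m) \<sqsubseteq>\<^bsub>\<Gamma>\<^esub> val (a \<otimes> g [^] m))"
    using coset_max[OF assms] by blast
  from someI_ex[OF this] show "best a \<in> carrier G"
    and "h \<in> carrier G \<Longrightarrow> val (a \<otimes> h [^] m) \<sqsubseteq>\<^bsub>\<Gamma>\<^esub> max_val a"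
    by (auto simp: best_def max_val_def)
qed

lemma max_val_closed: "a \<in> carrier G \<Longrightarrow> max_val a \<in> carrier \<Gamma>"
  by (simp add: max_val_def best_closed)

text \<open>The maximum over the coset is attained, so the condition on all \<open>g\<close> reduces
  to the one at \<open>best a\<close>.\<close>

lemma V_eq_max_val:
  assumes a: "a \<in> carrier G"
  shows "V m a = {x \<in> carrier G. max_val a \<sqsubset>\<^bsub>\<Gamma>\<^esub> val x}"
proof -
  have "val (a \<otimes> g [^] m) \<sqsubset>\<^bsub>\<Gamma>\<^esub> val x"
    if "x \<in> carrier G" "max_val a \<sqsubset>\<^bsub>\<Gamma>\<^esub> val x" "g \<in> carrier G" for x g
    using le_trans_less[OF _ _ _ val_le_max_val[OF a that(3)] that(2)] that a max_val_closed
    by simp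
  then show ?thesis
    using best_closed[OF a] by (auto simp: V_mod_def max_val_def)
qed

text \<open>Carries the order of induced values over to \<open>\<Gamma>\<close>; the comparison
  lemmas for \<open>w\<close> rest on it.\<close>

lemma V_subset_iff:
  assumes a: "a \<in> carrier G" and b: "b \<in> carrier G"
  shows "V m b \<subseteq> V m a \<longleftrightarrow> max_val a \<sqsubseteq>\<^bsub>\<Gamma>\<^esub> max_val b"
proof
  assume "max_val a \<sqsubseteq>\<^bsub>\<Gamma>\<^esub> max_val b"
  then show "V m b \<subseteq> V m a"
    using a b le_trans_less[OF max_val_closed[OF a] max_val_closed[OF b] val_closed]
    by (auto simp: V_eq_max_val)
next
  assume sub: "V m b \<subseteq> V m a"
  \<comment> \<open>The optimal coset element of \<open>a\<close> has value
    \<open>max_val a\<close>: it is outside \<open>V m a\<close>, but would be in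
    \<open>V m b\<close> if \<open>max_val b\<close> were smaller.\<close>
  have x: "a \<otimes> best a [^] m \<in> carrier G" using a best_closed by simp
  moreover have "a \<otimes> best a [^] m \<notin> V m a"
    using a by (simp add: V_eq_max_val max_val_def less_iff)
  ultimately have "\<not> max_val b \<sqsubset>\<^bsub>\<Gamma>\<^esub> max_val a"
    using sub b by (auto simp: V_eq_max_val max_val_def)
  then show "max_val a \<sqsubseteq>\<^bsub>\<Gamma>\<^esub> max_val b"
    using not_less_iff max_val_closed a b by blast
qed

abbreviation "Q \<equiv> G Mod multiples G m"
abbreviation "L \<equiv> order_mod G \<Gamma> val m"
abbreviation "w \<equiv> val_quot G \<Gamma> val m"
abbreviation "p a \<equiv> multiples G m #> a"

text \<open>Makes the ultrametric lemmas, such as \<open>val_mult_eq\<close>, available for the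
  quotient under the prefix \<open>quot\<close>.\<close>

sublocale quot: valued_abelian_group Q L "multiples G m" w
  by (rule induced_valued_abelian_group)

lemma carrier_quot: "carrier Q = p ` carrier G"
  by (simp add: carrier_FactGroup)

lemma quot_diff:
  assumes "a \<in> carrier G" "b \<in> carrier G"
  shows "p a \<otimes>\<^bsub>Q\<^esub> inv\<^bsub>Q\<^esub> p b = p (a \<otimes> inv b)"
proof -
  interpret N: normal "multiples G m" G by (rule normal_multiples)
  show ?thesis
    using assms carrier_quot by (simp add: N.inv_FactGroup N.rcos_inv N.rcos_sum)
qed

lemma w_le_iff:
  assumes "a \<in> carrier G" "b \<in> carrier G"
  shows "w (p a) \<sqsubseteq>\<^bsub>L\<^esub> w (p b) \<longleftrightarrow> max_val a \<sqsubseteq>\<^bsub>\<Gamma>\<^esub> max_val b"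
  using assms by (simp add: val_quot_coset val_mod_le_iff V_subset_iff)

lemma w_eq_iff:
  assumes "a \<in> carrier G" "b \<in> carrier G"
  shows "w (p a) = w (p b) \<longleftrightarrow> max_val a = max_val b"
proof -
  have "w (p a) = w (p b) \<longleftrightarrow> V m a \<subseteq> V m b \<and> V m b \<subseteq> V m a"
    using assms by (auto simp: val_quot_coset val_mod_eq_iff)
  also have "\<dots> \<longleftrightarrow> max_val a = max_val b"
    using assms value_order.weak_le_antisym max_val_closed
    by (auto simp: V_subset_iff value_order.eq_is_equal)
  finally show ?thesis .
qed

lemma w_less_iff:
  assumes "a \<in> carrier G" "b \<in> carrier G"
  shows "w (p a) \<sqsubset>\<^bsub>L\<^esub> w (p b) \<longleftrightarrow> max_val a \<sqsubset>\<^bsub>\<Gamma>\<^esub> max_val b"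
  using assms by (simp add: quot.less_iff less_iff w_le_iff w_eq_iff)

section \<open>Representatives of cosets and approximation within a coset\<close>

lemma max_val_coset:
  assumes "a \<in> carrier G" "b \<in> p a"
  shows "max_val b = max_val a"
proof -
  have "p a = p b"
    using repr_independence[OF assms(2,1) subgroup_multiples] .
  moreover have "b \<in> carrier G"
    using assms r_coset_subset_G subgroup.subset[OF subgroup_multiples] by blast
  ultimately show ?thesis using w_eq_iff[of b a] assms by simp
qed

lemma val_le_max_val_self:
  assumes "a \<in> carrier G"
  shows "val a \<sqsubseteq>\<^bsub>\<Gamma>\<^esub> max_val a"
  using val_le_max_val[OF assms, of \<one>] assms by simp

text \<open>The ultrametric inequality of the quotient, read on representatives by
  \<open>w_le_iff\<close>.\<close>

lemma max_val_diff_ge: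
  assumes a: "a \<in> carrier G" and b: "b \<in> carrier G" and x: "x \<in> carrier \<Gamma>"
    and le: "x \<sqsubseteq>\<^bsub>\<Gamma>\<^esub> max_val a" "x \<sqsubseteq>\<^bsub>\<Gamma>\<^esub> max_val b"
  shows "x \<sqsubseteq>\<^bsub>\<Gamma>\<^esub> max_val (a \<otimes> inv b)"
proof (cases "max_val a \<sqsubseteq>\<^bsub>\<Gamma>\<^esub> max_val b")
  case True
  then have "max_val a \<sqsubseteq>\<^bsub>\<Gamma>\<^esub> max_val (a \<otimes> inv b)"
    using quot.val_diff[of "p a" "p b"] a b carrier_quot
    by (simp add: quot_diff w_le_iff del: mult_FactGroup)
  then show ?thesis
    using value_order.le_trans[OF le(1)] a b x max_val_closed by simp
next
  case False
  then have "max_val b \<sqsubseteq>\<^bsub>\<Gamma>\<^esub> max_val (a \<otimes> inv b)"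
    using quot.val_diff[of "p a" "p b"] a b carrier_quot
    by (simp add: quot_diff w_le_iff del: mult_FactGroup)
  then show ?thesis
    using value_order.le_trans[OF le(2)] a b x max_val_closed by simp
qed

text \<open>Shifted by \<open>b\<close>, the coset of \<open>a\<close> becomes that of
  \<open>a \<otimes> inv b\<close>, whose element of largest value gives the closest approach to
  \<open>b\<close>.\<close>

lemma coset_near:
  assumes a: "a \<in> carrier G" and b: "b \<in> carrier G"
  shows "\<exists>x \<in> p a. val (x \<otimes> inv b) = max_val (a \<otimes> inv b)"
proof -
  let ?g = "best (a \<otimes> inv b)"
  have g: "?g \<in> carrier G" using best_closed a b by simp
  have "?g [^] m \<otimes> a \<in> p a"
    using g by (auto simp: r_coset_def multiples_def)
  moreover have "(?g [^] m \<otimes> a) \<otimes> inv b = (a \<otimes> inv b) \<otimes> ?g [^] m"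
    using a b g by (simp add: m_ac)
  ultimately show ?thesis by (metis max_val_def)
qed

text \<open>Equal cosets have equal differences in the quotient. The second conclusion concerns
  \<open>x\<close> alone and is used with \<open>b = a\<close> and \<open>y = x\<close>.\<close>

lemma coset_diff:
  assumes a: "a \<in> carrier G" and b: "b \<in> carrier G" and x: "x \<in> p a" and y: "y \<in> p b"
  shows "x \<otimes> inv y \<in> p (a \<otimes> inv b)" "x \<in> carrier G"
proof -
  interpret N: normal "multiples G m" G by (rule normal_multiples)
  have sub: "p c \<subseteq> carrier G" if "c \<in> carrier G" for c
    using that r_coset_subset_G N.subset by blast
  then show xG: "x \<in> carrier G" using a x by blast
  have yG: "y \<in> carrier G" using sub b y by blast
  have "p a = p x" "p b = p y"
    using repr_independence[OF x a] repr_independence[OF y b] subgroup_multiples by auto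
  then have "p (a \<otimes> inv b) = p (x \<otimes> inv y)"
    using quot_diff[OF a b] quot_diff[OF xG yG] by simp
  then show "x \<otimes> inv y \<in> p (a \<otimes> inv b)"
    using rcos_self[of "x \<otimes> inv y"] subgroup_multiples xG yG by simp
qed

section \<open>Lifting pseudo-Cauchy sequences of cosets\<close>

theorem pseudo_complete_quot: "pseudo_complete TYPE('i) Q L w"
  unfolding pseudo_complete_def
proof (intro allI impI, elim conjE)
  fix r :: "'i rel" and A
  assume io: "index_order r" and AQ: "A ` Field r \<subseteq> carrier Q" and "pseudo_Cauchy Q L w r A"
  then obtain \<alpha> where \<alpha>: "\<alpha> \<in> Field r" and cau: "\<And>i j k.
        (\<alpha>, i) \<in> r - Id \<Longrightarrow> (i, j) \<in> r - Id \<Longrightarrow> (j, k) \<in> r - Id \<Longrightarrow>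
        w (A i \<otimes>\<^bsub>Q\<^esub> inv\<^bsub>Q\<^esub> A j) \<sqsubset>\<^bsub>L\<^esub> w (A j \<otimes>\<^bsub>Q\<^esub> inv\<^bsub>Q\<^esub> A k)"
    unfolding pseudo_Cauchy_def by blast
  have wo: "Well_order r" and nomax: "\<And>i. i \<in> Field r \<Longrightarrow> \<exists>j. (i, j) \<in> r - Id"
    using io by (auto simp: index_order_def)
  have wf: "wf (r - Id)" and trans: "\<And>i j k. (i, j) \<in> r \<Longrightarrow> (j, k) \<in> r \<Longrightarrow> (i, k) \<in> r"
    and antisym: "\<And>i j. (i, j) \<in> r \<Longrightarrow> (j, i) \<in> r \<Longrightarrow> i = j"
    using wo by (auto simp: order_on_defs dest: transD antisymD)
  have "\<forall>i\<in>Field r. \<exists>a. a \<in> carrier G \<and> A i = p a"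
    using AQ carrier_quot by blast
  then obtain a where a: "\<And>i. i \<in> Field r \<Longrightarrow> a i \<in> carrier G" "\<And>i. i \<in> Field r \<Longrightarrow> A i = p (a i)"
    by metis
  define T where "T = {i. (\<alpha>, i) \<in> r - Id}"
  have TF: "T \<subseteq> Field r" by (auto simp: T_def Field_def)
  then have aT: "a i \<in> carrier G" if "i \<in> T" for i using that a by blast
  have Tup: "j \<in> T" if "i \<in> T" "(i, j) \<in> r" for i j
    using that trans[of \<alpha> i j] antisym[of \<alpha> i] unfolding T_def by auto
  have less_trans: "(i, k) \<in> r - Id" if "(i, j) \<in> r - Id" "(j, k) \<in> r - Id" for i j k
    using that trans[of i j k] antisym[of i j] by auto
  have w_diff: "w (A i \<otimes>\<^bsub>Q\<^esub> inv\<^bsub>Q\<^esub> A j) = w (p (a i \<otimes> inv a j))"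
    if "i \<in> T" "j \<in> T" for i j
    using that TF a quot_diff by (simp add: subset_iff)
  have M_less: "max_val (a i \<otimes> inv a j) \<sqsubset>\<^bsub>\<Gamma>\<^esub> max_val (a j \<otimes> inv a k)"
    if "i \<in> T" "(i, j) \<in> r - Id" "(j, k) \<in> r - Id" for i j k
  proof -
    have jk: "j \<in> T" "k \<in> T" using Tup that by blast+
    then show ?thesis
      using cau[of i j k] that w_less_iff aT w_diff[OF that(1) jk(1)] w_diff[OF jk]
      by (simp add: T_def)
  qed
  \<comment> \<open>The term from \<open>j\<close> to \<open>k\<close> has strictly larger induced
    value, so it does not affect the value of the sum.\<close>
  have M_const': "max_val (a i \<otimes> inv a k) = max_val (a i \<otimes> inv a j)"
    if i: "i \<in> T" and ij: "(i, j) \<in> r - Id" and jk: "(j, k) \<in> r - Id" for i j k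
  proof -
    have jT: "j \<in> T" and kT: "k \<in> T" using Tup that by blast+
    have car: "a i \<in> carrier G" "a j \<in> carrier G" "a k \<in> carrier G" using aT i jT kT by auto
    have "w (p (a i \<otimes> inv a k))
        = w ((p (a i) \<otimes>\<^bsub>Q\<^esub> inv\<^bsub>Q\<^esub> p (a j)) \<otimes>\<^bsub>Q\<^esub> (p (a j) \<otimes>\<^bsub>Q\<^esub> inv\<^bsub>Q\<^esub> p (a k)))"
      using car carrier_quot quot.mult_diff[of "p (a i)" "p (a j)" "p (a k)"]
      by (simp add: quot_diff del: mult_FactGroup)
    also have "\<dots> = w (p (a i) \<otimes>\<^bsub>Q\<^esub> inv\<^bsub>Q\<^esub> p (a j))"
      using car carrier_quot M_less[OF that]
      by (intro quot.val_mult_eq) (auto simp: quot_diff w_less_iff simp del: mult_FactGroup)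
    finally show ?thesis using car by (simp add: quot_diff w_eq_iff del: mult_FactGroup)
  qed
  \<comment> \<open>\<open>s i\<close> is an arbitrary later index; \<open>M_const\<close> shows
    that \<open>\<gamma> i\<close> does not depend on it.\<close>
  define s where "s i = (SOME j. (i, j) \<in> r - Id)" for i
  have s: "(i, s i) \<in> r - Id" if "i \<in> T" for i
    using someI_ex[OF nomax[of i]] that TF unfolding s_def by blast
  define \<gamma> where "\<gamma> i = max_val (a i \<otimes> inv a (s i))" for i
  have M_const: "max_val (a i \<otimes> inv a j) = \<gamma> i" if i: "i \<in> T" and ij: "(i, j) \<in> r - Id" for i j
  proof -
    have sT: "s i \<in> T" and jT: "j \<in> T" using Tup s[OF i] i ij by blast+
    have total: "total_on (Field r) r" using wo by (simp add: order_on_defs)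
    consider "s i = j" | "(s i, j) \<in> r - Id" | "(j, s i) \<in> r - Id"
      using total sT jT TF unfolding total_on_def by blast
    then show ?thesis
    proof cases
      case 2
      then show ?thesis using M_const'[OF i s[OF i] 2] by (simp add: \<gamma>_def)
    next
      case 3
      then show ?thesis using M_const'[OF i ij 3] by (simp add: \<gamma>_def)
    qed (simp add: \<gamma>_def)
  qed
  have \<gamma>_car: "\<gamma> i \<in> carrier \<Gamma>" if "i \<in> T" for i
    using max_val_closed aT Tup[OF that] s that unfolding \<gamma>_def by simp
  have \<gamma>_mono: "\<gamma> i \<sqsubset>\<^bsub>\<Gamma>\<^esub> \<gamma> j" if "i \<in> T" "(i, j) \<in> r - Id" for i j
  proof -
    have "j \<in> T" using that Tup by blast
    then show ?thesis
      using M_less[OF that s] M_const[OF that] by (simp add: \<gamma>_def)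
  qed
  have pcI: "pseudo_complete TYPE('i) G \<Gamma> val"
    by (rule pseudo_complete_all_index_types[OF complete])
  \<comment> \<open>\<open>x\<close> is an admissible lift at stage \<open>j\<close> over the
    earlier lifts \<open>f\<close>. Outside \<open>T\<close> the condition is vacuous, because the
    recursion runs over the whole index type.\<close>
  define P where "P f j x \<longleftrightarrow> (j \<in> T \<longrightarrow> x \<in> p (a j) \<and>
      (\<forall>i\<in>T. (i, j) \<in> r - Id \<longrightarrow> val (f i \<otimes> inv x) = \<gamma> i))" for f j x
  have "\<exists>f. \<forall>j. P f j (f j)"
  proof (rule dependent_wf_choice[OF wf])
    fix f g :: "'i \<Rightarrow> 'a" and j x
    assume "\<And>z. (z, j) \<in> r - Id \<Longrightarrow> f z = g z"
    then show "P f j x = P g j x" unfolding P_def by auto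
  next
    fix j and f :: "'i \<Rightarrow> 'a"
    assume IH: "\<And>i. (i, j) \<in> r - Id \<Longrightarrow> P f i (f i)"
    show "\<exists>x. P f j x"
    proof (cases "j \<in> T")
      case j: True
      define B where "B = {i \<in> T. (i, j) \<in> r - Id}"
      have fB: "f i \<in> p (a i)" if "i \<in> B" for i
        using IH that by (auto simp: P_def B_def)
      have fG: "f i \<in> carrier G" if "i \<in> B" for i
        using coset_diff(2)[OF _ _ fB fB] aT that by (simp add: B_def)
      \<comment> \<open>\<open>B\<close> may be empty or have a last index, which
        \<open>pseudo_complete_balls\<close> permits. The point \<open>b\<close> may miss the coset
        \<open>p (a j)\<close>, hence the passage to the closest \<open>x\<close>.\<close>
      have "\<exists>b\<in>carrier G. \<forall>i\<in>B. \<gamma> i \<sqsubseteq>\<^bsub>\<Gamma>\<^esub> val (f i \<otimes> inv b)"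
      proof (rule pseudo_complete_balls[OF pcI wo])
        fix i k assume "i \<in> B" "k \<in> B" "(i, k) \<in> r - Id"
        then show "val (f i \<otimes> inv f k) = \<gamma> i"
          using IH[of k] by (auto simp: P_def B_def)
      qed (use TF fG \<gamma>_car \<gamma>_mono B_def in auto)
      then obtain b where b: "b \<in> carrier G"
        and fb: "\<And>i. i \<in> B \<Longrightarrow> \<gamma> i \<sqsubseteq>\<^bsub>\<Gamma>\<^esub> val (f i \<otimes> inv b)" by blast
      obtain x where x: "x \<in> p (a j)" and xb: "val (x \<otimes> inv b) = max_val (a j \<otimes> inv b)"
        using coset_near[OF aT[OF j] b] by blast
      have xG: "x \<in> carrier G" using coset_diff(2)[OF aT aT x x] j by blast
      \<comment> \<open>Upper bound: \<open>f i \<otimes> inv x\<close> has \<open>max_val\<close>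
        equal to \<open>\<gamma> i\<close>. Lower bound: \<open>x \<otimes> inv b\<close> is the
        difference of \<open>f i \<otimes> inv b\<close> and \<open>f i \<otimes> inv x\<close>, so
        its \<open>max_val\<close> is at least \<open>\<gamma> i\<close>; by the choice of
        \<open>x\<close> this is its actual value, and \<open>b\<close> links \<open>f i\<close> to
        \<open>x\<close>.\<close>
      have "val (f i \<otimes> inv x) = \<gamma> i" if i: "i \<in> T" "(i, j) \<in> r - Id" for i
      proof -
        have iB: "i \<in> B" using i by (simp add: B_def)
        note car = aT[OF i(1)] aT[OF j] b xG fG[OF iB] \<gamma>_car[OF i(1)]
        have bb: "b \<in> p b" using rcos_self[OF b subgroup_multiples] .
        have "\<gamma> i \<sqsubseteq>\<^bsub>\<Gamma>\<^esub> max_val (f i \<otimes> inv b)"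
          using value_order.le_trans[OF fb[OF iB] val_le_max_val_self] car max_val_closed by simp
        moreover have fx: "f i \<otimes> inv x \<in> p (a i \<otimes> inv a j)"
          using coset_diff(1) car fB[OF iB] x by blast
        then have Mfx: "max_val (f i \<otimes> inv x) = \<gamma> i"
          using max_val_coset[OF _ fx] M_const[OF i] car by simp
        moreover have "(f i \<otimes> inv b) \<otimes> inv (f i \<otimes> inv x) = x \<otimes> inv b"
          using mult_diff[of x "f i" b] car by (simp add: inv_mult_group m_comm)
        ultimately have "\<gamma> i \<sqsubseteq>\<^bsub>\<Gamma>\<^esub> max_val (x \<otimes> inv b)"
          using max_val_diff_ge[of "f i \<otimes> inv b" "f i \<otimes> inv x" "\<gamma> i"] car by simp
        moreover have "max_val (x \<otimes> inv b) = max_val (a j \<otimes> inv b)"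
          using max_val_coset[OF _ coset_diff(1)[OF _ _ x bb]] car by simp
        ultimately have "\<gamma> i \<sqsubseteq>\<^bsub>\<Gamma>\<^esub> val (x \<otimes> inv b)" using xb by simp
        then have "\<gamma> i \<sqsubseteq>\<^bsub>\<Gamma>\<^esub> val ((f i \<otimes> inv b) \<otimes> (b \<otimes> inv x))"
          using fb[OF iB] car by - (rule val_mult_ge, auto simp: val_diff_commute[of b x])
        then have "\<gamma> i \<sqsubseteq>\<^bsub>\<Gamma>\<^esub> val (f i \<otimes> inv x)" using mult_diff car by simp
        moreover have "val (f i \<otimes> inv x) \<sqsubseteq>\<^bsub>\<Gamma>\<^esub> \<gamma> i"
          using val_le_max_val_self[of "f i \<otimes> inv x"] Mfx car by simp
        ultimately show ?thesis
          using value_order.weak_le_antisym car by (simp add: value_order.eq_is_equal)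
      qed
      then show ?thesis using x unfolding P_def by blast
    qed (simp add: P_def)
  qed
  then obtain f where f: "\<And>j. P f j (f j)" by blast
  have fp: "f i \<in> p (a i)" if "i \<in> T" for i using f that by (auto simp: P_def)
  have fG: "f i \<in> carrier G" if "i \<in> T" for i
    using coset_diff(2)[OF _ _ fp fp] aT that by simp
  have "\<exists>b\<in>carrier G. \<forall>i\<in>T. \<gamma> i \<sqsubseteq>\<^bsub>\<Gamma>\<^esub> val (f i \<otimes> inv b)"
  proof (rule pseudo_complete_balls[OF pcI wo])
    fix i j assume "i \<in> T" "j \<in> T" "(i, j) \<in> r - Id"
    then show "val (f i \<otimes> inv f j) = \<gamma> i"
      using f[of j] by (auto simp: P_def)
  qed (use TF fG \<gamma>_car \<gamma>_mono in auto)
  then obtain b where b: "b \<in> carrier G"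
    and fb: "\<And>i. i \<in> T \<Longrightarrow> \<gamma> i \<sqsubseteq>\<^bsub>\<Gamma>\<^esub> val (f i \<otimes> inv b)" by blast
  \<comment> \<open>\<open>max_val\<close> dominates \<open>val\<close> and depends only on cosets,
    so the bound for the lift descends to the given cosets.\<close>
  have M_ge: "\<gamma> i \<sqsubseteq>\<^bsub>\<Gamma>\<^esub> max_val (a i \<otimes> inv b)" if i: "i \<in> T" for i
  proof -
    note car = aT[OF i] b fG[OF i] \<gamma>_car[OF i]
    have bb: "b \<in> p b" using rcos_self[OF b subgroup_multiples] .
    have "max_val (f i \<otimes> inv b) = max_val (a i \<otimes> inv b)"
      using max_val_coset[OF _ coset_diff(1)[OF _ _ fp[OF i] bb]] car by simp
    then show ?thesis
      using value_order.le_trans[OF fb[OF i] val_le_max_val_self] car max_val_closed by simp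
  qed
  have "w (A i \<otimes>\<^bsub>Q\<^esub> inv\<^bsub>Q\<^esub> p b) = w (A i \<otimes>\<^bsub>Q\<^esub> inv\<^bsub>Q\<^esub> A j)"
    if i: "i \<in> T" and ij: "(i, j) \<in> r - Id" for i j
  proof -
    have j: "j \<in> T" using Tup i ij by blast
    note car = aT[OF i] aT[OF j] b
    have A: "A i = p (a i)" "A j = p (a j)" using a i j TF by auto
    have pQ: "p (a i) \<in> carrier Q" "p (a j) \<in> carrier Q" "p b \<in> carrier Q"
      using car carrier_quot by auto
    \<comment> \<open>Going from \<open>a i\<close> to \<open>b\<close> through \<open>a j\<close>,
      the second term has induced value at least \<open>\<gamma> j\<close>, above
      \<open>\<gamma> i\<close>, so \<open>quot.val_mult_eq\<close> discards it.\<close>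
    have "max_val (a i \<otimes> inv a j) \<sqsubset>\<^bsub>\<Gamma>\<^esub> max_val (a j \<otimes> inv b)"
      unfolding M_const[OF i ij]
      using less_trans_le[OF _ _ _ \<gamma>_mono[OF i ij] M_ge[OF j]] \<gamma>_car i j car max_val_closed by simp
    then have "w ((p (a i) \<otimes>\<^bsub>Q\<^esub> inv\<^bsub>Q\<^esub> p (a j)) \<otimes>\<^bsub>Q\<^esub> (p (a j) \<otimes>\<^bsub>Q\<^esub> inv\<^bsub>Q\<^esub> p b))
        = w (p (a i) \<otimes>\<^bsub>Q\<^esub> inv\<^bsub>Q\<^esub> p (a j))"
      using carrier_quot car
      by (intro quot.val_mult_eq) (auto simp: quot_diff w_less_iff simp del: mult_FactGroup)
    then show ?thesis using quot.mult_diff[OF pQ] A by simp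
  qed
  then have "pseudo_limit Q w r A (p b)"
    unfolding pseudo_limit_def using \<alpha> by (auto simp: T_def)
  moreover have "p b \<in> carrier Q" using b carrier_quot by blast
  ultimately show "\<exists>l\<in>carrier Q. pseudo_limit Q w r A l" by blast
qed

end

theorem proposition1p47:
  fixes G :: "('a, 'b) monoid_scheme" and \<Gamma> :: "('v, 'c) gorder_scheme"
    and infty :: 'v and val :: "'a \<Rightarrow> 'v" and m :: nat
  assumes "valued_abelian_group G \<Gamma> infty val"
    and "Z_invariant G val"
    and "pseudo_complete TYPE('a) G \<Gamma> val"
    and "m > 0"
  shows "pseudo_complete TYPE('i) (G Mod multiples G m) (order_mod G \<Gamma> val m) (val_quot G \<Gamma> val m)"
proof -
  interpret mod_valued_group G \<Gamma> infty val m
    using assms by (simp add: mod_valued_group_def mod_valued_group_axioms_def)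
  show ?thesis by (rule pseudo_complete_quot)
qed

end
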